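(* Let $N\ge 1$ be an integer and let $P_n(x)$, $n=0,1,\dots,N$, be the Sturmian sequence of polynomials on the quadratic grid $x_s=s(s+2)$, $s=0,1,\dots,N$. Let $R_n(x)$ be the monic Racah polynomials with parameters $\alpha=-N-1$, $\beta=-N-\tfrac32$, $\gamma=\delta=\tfrac12$. Then $P_n(x)$ is the Christoffel transform of these Racah polynomials at the point $-1$: $$P_n(x)=\frac{R_{n+1}(x)-\dfrac{R_{n+1}(-1)}{R_n(-1)}\,R_n(x)}{x+1},\qquad n=0,1,\dots,N.$$
   Context: Sturmian sequence on a grid: given distinct real numbers $x_0,\dots,x_N$, put $P_{N+1}(x)=\prod_{s=0}^N(x-x_s)$ and $P_N(x)=(N+1)^{-1}P_{N+1}'(x)$. The Euclidean algorithm produces uniquely monic polynomials $P_{N-1},\dots,P_0=1$ ($\deg P_n=n$), real $b_n$ and $u_n>0$ with $P_{n+1}(x)=(x-b_n)P_n(x)-u_nP_{n-1}(x)$ for $n=1,\dots,N$, and $P_1(x)=x-b_0$. The polynomials $P_0,\dots,P_N$ form the Sturmian sequence. Racah polynomials with $\alpha=-N-1$: for $0\le n\le N$, $R_n(x)$ is the monic polynomial of degree $n$ in $x$ determined by $$R_n(x(s))=\kappa_n\;{}_4F_3\left({-n,\ n+\beta-N,\ -s,\ s+\gamma+\delta+1\atop -N,\ \beta+\delta+1,\ \gamma+1};1\right),\qquad x(s)=s(s+\gamma+\delta+1),$$ where $\kappa_n$ is the constant making the polynomial monic in $x$, and the series is the finite sum of its terms with index $k=0,\dots,n$ (each product $(-s)_k(s+\gamma+\delta+1)_k$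 is a polynomial of degree $k$ in $x(s)$; $(y)_k=y(y+1)\cdots(y+k-1)$). For $n=N+1$, $R_{N+1}(x)=\prod_{s=0}^N(x-x(s))$, the monic polynomial vanishing on the whole grid. *)

theory Defs
  imports Complex_Main "HOL-Computational_Algebra.Polynomial"
begin

definition make_monic :: "real poly \<Rightarrow> real poly" where
  "make_monic p = smult (inverse (lead_coeff p)) p"

definition grid_poly :: "nat \<Rightarrow> (nat \<Rightarrow> real) \<Rightarrow> real poly" where
  "grid_poly N x = (\<Prod>s\<le>N. [:- x s, 1:])"

text \<open>
  The Euclidean algorithm started at \<open>P\<^sub>N\<^sub>+\<^sub>1\<close> and \<open>P\<^sub>N\<close>, indexed by the number of steps, so that
  \<open>euclid_seq N x k\<close> is \<open>P\<^sub>N\<^sub>+\<^sub>1\<^sub>-\<^sub>k\<close>. In the recurrence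
  \<open>P\<^sub>n\<^sub>+\<^sub>1 = (x - b\<^sub>n) P\<^sub>n - u\<^sub>n P\<^sub>n\<^sub>-\<^sub>1\<close> the remainder of \<open>P\<^sub>n\<^sub>+\<^sub>1\<close> modulo \<open>P\<^sub>n\<close> is
  \<open>- u\<^sub>n P\<^sub>n\<^sub>-\<^sub>1\<close>; \<open>P\<^sub>n\<^sub>-\<^sub>1\<close> is its monic normalisation.
\<close>

fun euclid_seq :: "nat \<Rightarrow> (nat \<Rightarrow> real) \<Rightarrow> nat \<Rightarrow> real poly" where
  "euclid_seq N x 0 = grid_poly N x"
| "euclid_seq N x (Suc 0) = smult (inverse (real (N + 1))) (pderiv (grid_poly N x))"
| "euclid_seq N x (Suc (Suc k)) = make_monic (- (euclid_seq N x k mod euclid_seq N x (Suc k)))"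

definition sturmian_poly :: "nat \<Rightarrow> (nat \<Rightarrow> real) \<Rightarrow> nat \<Rightarrow> real poly" where
  "sturmian_poly N x n = euclid_seq N x (N + 1 - n)"

text \<open>
  Any sequence of monic polynomials that satisfies the three-term recurrence and ends in
  \<open>P\<^sub>N\<close>, \<open>P\<^sub>N\<^sub>+\<^sub>1\<close> is the one computed by the algorithm.
\<close>

lemma sturmian_poly_unique:
  assumes top: "P (N + 1) = grid_poly N x"
      "P N = smult (inverse (real (N + 1))) (pderiv (grid_poly N x))"
    and monic: "\<And>n. n \<le> N + 1 \<Longrightarrow> degree (P n) = n \<and> lead_coeff (P n) = 1"
    and rec: "\<And>n. 1 \<le> n \<Longrightarrow> n \<le> N \<Longrightarrow>
      u n > 0 \<and> P (n + 1) = [:- b n, 1:] * P n - smult (u n) (P (n - 1))"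
    and n: "n \<le> N + 1"
  shows "sturmian_poly N x n = P n"
proof -
  have "k \<le> N + 1 \<Longrightarrow> euclid_seq N x k = P (N + 1 - k)" for k
  proof (induction k rule: less_induct)
    case (less k)
    consider "k = 0" | "k = 1" | j where "k = Suc (Suc j)"
      by (metis One_nat_def not0_implies_Suc)
    then show ?case
    proof cases
      case 3
      define m where "m = N - j"
      have m: "1 \<le> m" "m \<le> N" "N + 1 - j = m + 1" "N + 1 - Suc j = m" "N + 1 - k = m - 1"
        using less.prems 3 by (auto simp: m_def)
      have IH: "euclid_seq N x j = P (m + 1)" "euclid_seq N x (Suc j) = P m"
        using less.IH[of j] less.IH[of "Suc j"] less.prems m 3 by auto
      have u: "u m > 0" and r: "P (m + 1) = [:- b m, 1:] * P m - smult (u m) (P (m - 1))"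
        using rec[of m] m by auto
      have deg: "degree (smult (u m) (P (m - 1))) < degree (P m)"
        using monic[of m] monic[of "m - 1"] m u by auto
      have "P (m + 1) = - smult (u m) (P (m - 1)) + [:- b m, 1:] * P m"
        by (simp only: r uminus_add_conv_diff)
      then have "P (m + 1) mod P m = - smult (u m) (P (m - 1)) mod P m"
        by (simp only: mod_mult_self1)
      also have "\<dots> = - smult (u m) (P (m - 1))"
        using deg by (intro mod_poly_less) simp
      finally have "euclid_seq N x k = make_monic (smult (u m) (P (m - 1)))"
        by (simp add: 3 IH)
      also have "\<dots> = P (m - 1)"
      proof -
        have "m - 1 \<le> N + 1" using m by linarith
        then have "lead_coeff (P (m - 1)) = 1" using monic by blast
        then show ?thesis using u by (simp add: make_monic_def)
      qed
      finally show ?thesis using m by simp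
    qed (use top in simp_all)
  qed
  then show ?thesis using n by (simp add: sturmian_poly_def)
qed

definition racah_grid :: "real \<Rightarrow> real \<Rightarrow> real \<Rightarrow> real" where
  "racah_grid \<gamma> \<delta> s = s * (s + \<gamma> + \<delta> + 1)"

text \<open>
  The terminating hypergeometric sum as a polynomial in the grid variable \<open>x = x(s)\<close>, using
  \<open>(-s + j) (s + \<gamma> + \<delta> + 1 + j) = x(j) - x(s)\<close>; see \<open>poly_racah_hyp\<close> below.
\<close>

definition racah_hyp :: "nat \<Rightarrow> real \<Rightarrow> real \<Rightarrow> real \<Rightarrow> nat \<Rightarrow> real poly" where
  "racah_hyp N \<beta> \<gamma> \<delta> n =
    (\<Sum>k\<le>n. smult
       (pochhammer (- real n) k * pochhammer (real n + \<beta> - real N) k /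
        (pochhammer (- real N) k * pochhammer (\<beta> + \<delta> + 1) k * pochhammer (\<gamma> + 1) k * fact k))
       (\<Prod>j<k. [:racah_grid \<gamma> \<delta> (real j), -1:]))"

lemma poly_racah_hyp:
  "poly (racah_hyp N \<beta> \<gamma> \<delta> n) (racah_grid \<gamma> \<delta> s) =
    (\<Sum>k\<le>n.
       pochhammer (- real n) k * pochhammer (real n + \<beta> - real N) k *
       pochhammer (- s) k * pochhammer (s + \<gamma> + \<delta> + 1) k /
       (pochhammer (- real N) k * pochhammer (\<beta> + \<delta> + 1) k * pochhammer (\<gamma> + 1) k * fact k))"
proof -
  have "(\<Prod>j<k. poly [:racah_grid \<gamma> \<delta> (real j), -1:] (racah_grid \<gamma> \<delta> s)) =
      pochhammer (- s) k * pochhammer (s + \<gamma> + \<delta> + 1) k" for k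
    by (induction k) (simp_all add: pochhammer_Suc racah_grid_def algebra_simps)
  then show ?thesis
    by (simp add: racah_hyp_def poly_sum poly_prod mult.assoc del: poly_pCons)
qed

text \<open>
  Monic Racah polynomials with \<open>\<alpha> = -N-1\<close>, for \<open>n \<le> N + 1\<close>.
\<close>

definition racah_poly :: "nat \<Rightarrow> real \<Rightarrow> real \<Rightarrow> real \<Rightarrow> nat \<Rightarrow> real poly" where
  "racah_poly N \<beta> \<gamma> \<delta> n =
    (if n \<le> N then make_monic (racah_hyp N \<beta> \<gamma> \<delta> n)
     else grid_poly N (\<lambda>s. racah_grid \<gamma> \<delta> (real s)))"

lemma racah_poly_monic:
  assumes "n \<le> N" "pochhammer (real n + \<beta> - real N) n \<noteq> 0"
    "pochhammer (\<beta> + \<delta> + 1) n \<noteq> 0" "pochhammer (\<gamma> + 1) n \<noteq> 0"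
  shows "degree (racah_poly N \<beta> \<gamma> \<delta> n) = n" "lead_coeff (racah_poly N \<beta> \<gamma> \<delta> n) = 1"
proof -
  define q :: "nat \<Rightarrow> real poly" where "q k = (\<Prod>j<k. [:racah_grid \<gamma> \<delta> (real j), -1:])" for k
  have q: "degree (q k) = k \<and> q k \<noteq> 0" for k
    by (induction k) (auto simp: q_def degree_mult_eq simp del: mult_pCons_left mult_pCons_right)
  define c where "c k =
    pochhammer (- real n) k * pochhammer (real n + \<beta> - real N) k /
     (pochhammer (- real N) k * pochhammer (\<beta> + \<delta> + 1) k * pochhammer (\<gamma> + 1) k * fact k)" for k
  have H: "racah_hyp N \<beta> \<gamma> \<delta> n = (\<Sum>k\<le>n. smult (c k) (q k))"
    by (simp add: racah_hyp_def c_def q_def)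
  have cn: "c n \<noteq> 0"
    using assms by (simp add: c_def pochhammer_of_nat_eq_0_iff)
  have "coeff (racah_hyp N \<beta> \<gamma> \<delta> n) n = (\<Sum>k\<le>n. if k = n then c n * lead_coeff (q n) else 0)"
    unfolding H coeff_sum using q by (intro sum.cong) (auto simp: coeff_eq_0)
  then have "coeff (racah_hyp N \<beta> \<gamma> \<delta> n) n \<noteq> 0"
    using cn q[of n] leading_coeff_neq_0[of "q n"] by simp
  moreover have "degree (racah_hyp N \<beta> \<gamma> \<delta> n) \<le> n"
    unfolding H using q by (intro degree_sum_le) (auto intro: order_trans[OF degree_smult_le])
  ultimately have "degree (racah_hyp N \<beta> \<gamma> \<delta> n) = n" "lead_coeff (racah_hyp N \<beta> \<gamma> \<delta> n) \<noteq> 0"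
    by (auto simp: le_antisym le_degree)
  then show "degree (racah_poly N \<beta> \<gamma> \<delta> n) = n" "lead_coeff (racah_poly N \<beta> \<gamma> \<delta> n) = 1"
    using \<open>n \<le> N\<close> by (auto simp: racah_poly_def make_monic_def)
qed

text \<open>
  The polynomial division in the Christoffel transform is exact as soon as \<open>R\<^sub>n\<close> does not
  vanish at \<open>a\<close>.
\<close>

definition christoffel_transform :: "(nat \<Rightarrow> real poly) \<Rightarrow> real \<Rightarrow> nat \<Rightarrow> real poly" where
  "christoffel_transform R a n =
    (R (n + 1) - smult (poly (R (n + 1)) a / poly (R n) a) (R n)) div [:- a, 1:]"

lemma christoffel_transform_exact:
  assumes "poly (R n) a \<noteq> 0"
  shows "[:- a, 1:] * christoffel_transform R a n =
      R (n + 1) - smult (poly (R (n + 1)) a / poly (R n) a) (R n)"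
proof -
  have "[:- a, 1:] dvd R (n + 1) - smult (poly (R (n + 1)) a / poly (R n) a) (R n)"
    using assms by (simp add: poly_eq_0_iff_dvd [symmetric])
  then show ?thesis
    unfolding christoffel_transform_def by (rule dvd_mult_div_cancel)
qed

end

theory Submission
  imports Defs
begin

text \<open>
  Both sides are orthogonal polynomials for the same positive weight on the nodes
  \<open>x\<^sub>0, \<dots>, x\<^sub>N\<close>, and monic orthogonal polynomials for such a weight are unique
  (\<open>monic_orth_unique\<close>).

  For any grid with \<open>P(x) = (x - x\<^sub>0) \<dots> (x - x\<^sub>N)\<close>, the derivative \<open>P'\<close> is orthogonal to all
  polynomials of degree below \<open>N\<close> with respect to the weight \<open>1 / P'(x\<^sub>s)\<^sup>2\<close>, because
  \<open>\<Sum> q(x\<^sub>s) / P'(x\<^sub>s)\<close> is a divided difference. Orthogonal polynomials satisfy a three-term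
  recurrence with positive coefficients, and the recurrence starting from \<open>P\<close> and \<open>P' / (N + 1)\<close>
  is the Euclidean algorithm. Hence the Sturmian sequence is the sequence of orthogonal
  polynomials for \<open>1 / P'(x\<^sub>s)\<^sup>2\<close> (\<open>sturmian_poly_eq_monic_orth\<close>). For \<open>x\<^sub>s = s (s + 2)\<close> one finds
  \<open>P'(x\<^sub>s) = \<plusminus> (N - s)! (N + s + 2)! / (2 (s + 1)\<^sup>2)\<close>.

  On the other side, the Racah polynomials are eigenfunctions of a second-order difference
  operator that is self-adjoint for the weight
  \<open>w\<^sub>s = (2 (s + 1) / ((N - s)! (N + s + 2)!))\<^sup>2\<close>, with distinct eigenvalues, so they are
  orthogonal for \<open>w\<close> (\<open>monic_orth_racah\<close>). A Christoffel transform at a point \<open>a\<close> to the left of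
  the grid multiplies the weight by \<open>x\<^sub>s - a\<close> (\<open>monic_orth_christoffel\<close>); the same positivity
  shows that the polynomials do not vanish at \<open>a\<close>. For \<open>a = -1\<close> the factor is \<open>(s + 1)\<^sup>2\<close>, and
  \<open>(s + 1)\<^sup>2 w\<^sub>s = 1 / P'(x\<^sub>s)\<^sup>2\<close>.
\<close>

section \<open>Orthogonal polynomials on a finite grid\<close>

definition grid_sum :: "nat \<Rightarrow> (nat \<Rightarrow> real) \<Rightarrow> (nat \<Rightarrow> real) \<Rightarrow> real poly \<Rightarrow> real" where
  "grid_sum N w x p = (\<Sum>s\<le>N. w s * poly p (x s))"

text \<open>
  A monic polynomial of degree \<open>N + 1\<close> that vanishes on the whole grid counts as orthogonal
  too. This is what lets the grid polynomial close the sequence at \<open>n = N + 1\<close>.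
\<close>

definition monic_orth :: "nat \<Rightarrow> (nat \<Rightarrow> real) \<Rightarrow> (nat \<Rightarrow> real) \<Rightarrow> nat \<Rightarrow> real poly \<Rightarrow> bool" where
  "monic_orth N w x n p \<longleftrightarrow> degree p = n \<and> coeff p n = 1 \<and>
     (\<forall>q. degree q < n \<longrightarrow> grid_sum N w x (p * q) = 0)"

lemma grid_sum_add: "grid_sum N w x (p + q) = grid_sum N w x p + grid_sum N w x q"
  and grid_sum_diff: "grid_sum N w x (p - q) = grid_sum N w x p - grid_sum N w x q"
  and grid_sum_smult: "grid_sum N w x (smult c p) = c * grid_sum N w x p"
  by (simp_all add: grid_sum_def algebra_simps sum.distrib sum_subtractf sum_distrib_left)

lemma grid_sum_cong:
  assumes "\<And>s. s \<le> N \<Longrightarrow> w s = v s"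
  shows "grid_sum N w x = grid_sum N v x"
  using assms by (auto simp: grid_sum_def fun_eq_iff)

lemma monic_orth_cong:
  assumes "\<And>s. s \<le> N \<Longrightarrow> w s = v s"
  shows "monic_orth N w x n p = monic_orth N v x n p"
  using grid_sum_cong[of N w v x] assms by (simp add: monic_orth_def)

lemma degree_diff_monic_less:
  fixes p q :: "real poly"
  assumes "degree p = n" "coeff p n = 1" "degree q = n" "coeff q n = 1" "p \<noteq> q"
  shows "degree (p - q) < n"
proof -
  have "degree (p - q) \<le> n" using assms by (intro degree_diff_le) auto
  moreover have "degree (p - q) \<noteq> n"
  proof
    assume d: "degree (p - q) = n"
    have "lead_coeff (p - q) = 0" using assms d by simp
    then have "p - q = 0" by (rule leading_coeff_0_iff[THEN iffD1])
    then show False using assms by simp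
  qed
  ultimately show ?thesis by simp
qed

lemma monic_diff_lower_degree:
  fixes p r :: "real poly"
  assumes "degree p = n" "coeff p n = 1" "degree r < n"
  shows "degree (p - r) = n" "coeff (p - r) n = 1"
proof -
  have "degree (- r + p) = n" using assms degree_add_eq_right[of "- r" p] by simp
  then show "degree (p - r) = n" by simp
  show "coeff (p - r) n = 1" using assms by (simp add: coeff_eq_0)
qed

lemma prod_linear_monic:
  fixes x :: "nat \<Rightarrow> real"
  assumes "finite A"
  shows "degree (\<Prod>s\<in>A. [:- x s, 1:]) = card A" "coeff (\<Prod>s\<in>A. [:- x s, 1:]) (card A) = 1"
proof -
  show d: "degree (\<Prod>s\<in>A. [:- x s, 1:]) = card A"
    by (subst degree_prod_eq_sum_degree) simp_all
  have "lead_coeff (\<Prod>s\<in>A. [:- x s, 1:]) = 1" by (subst lead_coeff_prod) simp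
  then show "coeff (\<Prod>s\<in>A. [:- x s, 1:]) (card A) = 1" by (simp only: d)
qed

text \<open>
  Polynomials \<open>Q m\<close> of exact degree \<open>m < n\<close> span those of degree below \<open>n\<close>: the multiple of
  \<open>Q m\<close> that removes the coefficient of index \<open>m\<close> leaves a polynomial handled by induction.
\<close>

lemma grid_sum_eq_0_of_basis:
  assumes basis: "\<And>m. m < n \<Longrightarrow> degree (Q m) = m \<and> Q m \<noteq> 0"
    and orth: "\<And>m. m < n \<Longrightarrow> grid_sum N w x (p * Q m) = 0"
    and q: "degree q < n"
  shows "grid_sum N w x (p * q) = 0"
proof -
  (* Vanishing coefficients replace a degree bound, so that the induction can start at m = 0. *)
  have "m \<le> n \<Longrightarrow> \<forall>i\<ge>m. coeff q i = 0 \<Longrightarrow> grid_sum N w x (p * q) = 0" for m q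
  proof (induction m arbitrary: q)
    case 0
    then have "q = 0" by (auto simp: poly_eq_iff)
    then show ?case by (simp add: grid_sum_def)
  next
    case (Suc m)
    define c where "c = coeff q m / lead_coeff (Q m)"
    define r where "r = q - smult c (Q m)"
    have Qm: "degree (Q m) = m" "Q m \<noteq> 0" using basis[of m] Suc.prems by auto
    then have lc: "coeff (Q m) m \<noteq> 0" using leading_coeff_neq_0[of "Q m"] by simp
    have "coeff r i = 0" if "m \<le> i" for i
    proof (cases "i = m")
      case True
      then show ?thesis using Qm lc by (simp add: r_def c_def)
    next
      case False
      then show ?thesis using Qm that Suc.prems by (simp add: r_def coeff_eq_0)
    qed
    then have "grid_sum N w x (p * r) = 0" using Suc.IH[of r] Suc.prems by auto
    moreover have "p * q = p * r + smult c (p * Q m)" by (simp add: r_def algebra_simps)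
    ultimately show ?case using orth[of m] Suc.prems
      by (simp add: grid_sum_add grid_sum_smult)
  qed
  from this[of n q] show ?thesis using q by (simp add: coeff_eq_0)
qed

locale weighted_grid =
  fixes N :: nat and w x :: "nat \<Rightarrow> real"
  assumes inj: "inj_on x {..N}" and w_pos: "s \<le> N \<Longrightarrow> 0 < w s"
begin

lemma card_nodes: "card (x ` {..N}) = N + 1"
  using inj by (simp add: card_image)

text \<open>
  A polynomial of degree at most \<open>N\<close> cannot vanish on all \<open>N + 1\<close> nodes, so the bilinear form
  \<open>grid_sum N w x (p * q)\<close> is positive definite in these degrees. Everything below about
  orthogonal polynomials on the grid comes from this.
\<close>

lemma grid_sum_square_pos:
  assumes "degree p \<le> N" "p \<noteq> 0"
  shows "0 < grid_sum N w x (p * p)"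
proof -
  have "\<exists>s\<le>N. poly p (x s) \<noteq> 0"
  proof (rule ccontr)
    assume "\<not> ?thesis"
    then have "p = 0"
      using assms card_nodes by (intro poly_eqI_degree[of "x ` {..N}"]) auto
    then show False using assms by simp
  qed
  then obtain s where s: "s \<le> N" "poly p (x s) \<noteq> 0" by blast
  have "0 < w s * (poly p (x s) * poly p (x s))"
    using s w_pos[of s] by (auto simp: zero_less_mult_iff linorder_neq_iff)
  then show ?thesis
    unfolding grid_sum_def using s
    by (intro sum_pos2[of _ s]) (auto simp: less_imp_le[OF w_pos])
qed

text \<open>
  The difference of two candidates has degree below \<open>n\<close>, hence is orthogonal to both and so to
  itself. This still works for \<open>n = N + 1\<close>, where the difference has degree at most \<open>N\<close>.
\<close>

lemma monic_orth_unique: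
  assumes "monic_orth N w x n p" "monic_orth N w x n q" "n \<le> N + 1"
  shows "p = q"
proof (rule ccontr)
  assume "p \<noteq> q"
  then have deg: "degree (p - q) < n"
    using assms by (intro degree_diff_monic_less) (auto simp: monic_orth_def)
  then have "grid_sum N w x (p * (p - q)) = 0" "grid_sum N w x (q * (p - q)) = 0"
    using assms by (auto simp: monic_orth_def)
  then have "grid_sum N w x ((p - q) * (p - q)) = 0"
    by (simp add: left_diff_distrib grid_sum_diff)
  moreover have "0 < grid_sum N w x ((p - q) * (p - q))"
    using deg assms \<open>p \<noteq> q\<close> by (intro grid_sum_square_pos) auto
  ultimately show False by simp
qed

lemma grid_sum_mult_monic:
  assumes p: "monic_orth N w x n p" and q: "degree q = n" "coeff q n = 1"
  shows "grid_sum N w x (p * q) = grid_sum N w x (p * p)"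
proof (cases "q = p")
  case False
  then have "degree (q - p) < n"
    using assms by (intro degree_diff_monic_less) (auto simp: monic_orth_def)
  then have "grid_sum N w x (p * (q - p)) = 0" using p by (simp add: monic_orth_def)
  then show ?thesis by (simp add: right_diff_distrib grid_sum_diff)
qed simp

text \<open>
  With these \<open>b\<close> and \<open>u\<close> the right-hand side is monic of degree \<open>n + 1\<close> and orthogonal to
  \<open>P 0, \<dots>, P n\<close>, so by uniqueness it is \<open>P (n + 1)\<close>. Multiplication by \<open>x - b\<close> is symmetric for
  the bilinear form, which settles \<open>m < n - 1\<close>; the two remaining cases \<open>m = n - 1\<close> and \<open>m = n\<close>
  determine \<open>u\<close> and \<open>b\<close>. As a quotient of squared norms, \<open>u\<close> is positive.
\<close>

lemma three_term_recurrence: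
  assumes P: "\<And>m. m \<le> N + 1 \<Longrightarrow> monic_orth N w x m (P m)" and n: "1 \<le> n" "n \<le> N"
  defines "h m \<equiv> grid_sum N w x (P m * P m)"
  defines "b \<equiv> grid_sum N w x ([:0, 1:] * P n * P n) / h n" and "u \<equiv> h n / h (n - 1)"
  shows "0 < u \<and> P (n + 1) = [:- b, 1:] * P n - smult u (P (n - 1))"
proof -
  have deg: "degree (P m) = m" "coeff (P m) m = 1" "P m \<noteq> 0" if "m \<le> N + 1" for m
    using P[OF that] by (auto simp: monic_orth_def)
  have h: "0 < h m" if "m \<le> N" for m
    unfolding h_def using deg[of m] that by (intro grid_sum_square_pos) auto
  have orth: "grid_sum N w x (P m * q) = 0" if "m \<le> N + 1" "degree q < m" for m q
    using P[OF that(1)] that(2) by (simp add: monic_orth_def)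
  define Q where "Q = [:- b, 1:] * P n - smult u (P (n - 1))"
  have lin: "degree ([:- b, 1:] * P m) = m + 1" "coeff ([:- b, 1:] * P m) (m + 1) = 1"
    if "m \<le> N + 1" for m
  proof -
    show "degree ([:- b, 1:] * P m) = m + 1"
      using deg[OF that] by (subst degree_mult_eq) simp_all
    show "coeff ([:- b, 1:] * P m) (m + 1) = 1"
      using deg[OF that] by (simp add: coeff_eq_0)
  qed
  have "degree (smult u (P (n - 1))) < n + 1"
    using deg[of "n - 1"] n by (intro le_less_trans[OF degree_smult_le]) simp
  then have Qmonic: "degree Q = n + 1" "coeff Q (n + 1) = 1"
    unfolding Q_def using lin[of n] n by (intro monic_diff_lower_degree; simp)+
  have "grid_sum N w x (Q * P m) = 0" if m: "m < n + 1" for m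
  proof -
    have split: "grid_sum N w x (Q * P m) =
        grid_sum N w x (P n * ([:- b, 1:] * P m)) - u * grid_sum N w x (P (n - 1) * P m)"
    proof -
      have "Q * P m = P n * ([:- b, 1:] * P m) - smult u (P (n - 1) * P m)"
        by (simp add: Q_def algebra_simps del: mult_pCons_left mult_pCons_right)
      then show ?thesis by (simp only: grid_sum_diff grid_sum_smult)
    qed
    consider "m + 1 < n" | "m + 1 = n" | "m = n" using m by linarith
    then show ?thesis
    proof cases
      case 1
      then show ?thesis
        using split orth[of n "[:- b, 1:] * P m"] orth[of "n - 1" "P m"] lin[of m] deg[of m] n
        by simp
    next
      case 2
      then have "grid_sum N w x (P n * ([:- b, 1:] * P m)) = h n"
        unfolding h_def using lin[of m] n P[of n] by (intro grid_sum_mult_monic) simp_all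
      moreover have "u * h m = h n" using 2 h[of m] n by (auto simp: u_def)
      moreover have "n - 1 = m" using 2 by simp
      ultimately show ?thesis using split by (simp add: h_def)
    next
      case 3
      have "P n * ([:- b, 1:] * P n) = [:0, 1:] * P n * P n - smult b (P n * P n)"
        by (simp add: algebra_simps)
      then have "grid_sum N w x (P n * ([:- b, 1:] * P n)) = 0"
        using h[of n] n by (simp only: grid_sum_diff grid_sum_smult)
          (simp add: b_def h_def)
      moreover have "grid_sum N w x (P (n - 1) * P n) = 0"
        using orth[of n "P (n - 1)"] deg[of "n - 1"] n by (simp add: mult.commute)
      ultimately show ?thesis using split 3 by simp
    qed
  qed
  then have "grid_sum N w x (Q * q) = 0" if "degree q < n + 1" for q
    using grid_sum_eq_0_of_basis[of "n + 1" P N w x Q q] deg n that by simp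
  then have "monic_orth N w x (n + 1) Q"
    using Qmonic by (simp add: monic_orth_def)
  then have "P (n + 1) = Q" using P[of "n + 1"] n by (intro monic_orth_unique) auto
  then show ?thesis using h[of n] h[of "n - 1"] n by (simp add: Q_def u_def)
qed

text \<open>
  If \<open>R = (x - a) S\<close>, then orthogonality of \<open>R\<close> to \<open>S\<close> says that \<open>S\<close> has norm zero for the weight
  \<open>w s * (x s - a)\<close>. That weight is positive when \<open>a\<close> lies to the left of all nodes.
\<close>

lemma poly_monic_orth_nonzero:
  assumes R: "monic_orth N w x n R" and n: "n \<le> N" and a: "\<And>s. s \<le> N \<Longrightarrow> a < x s"
  shows "poly R a \<noteq> 0"
proof
  assume "poly R a = 0"
  then obtain S where S: "R = [:- a, 1:] * S" by (auto simp: poly_eq_0_iff_dvd)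
  have "S \<noteq> 0" using S R by (auto simp: monic_orth_def)
  then have deg: "n = degree S + 1"
    using R by (simp add: S monic_orth_def degree_mult_eq del: mult_pCons_left)
  then have "grid_sum N w x (R * S) = 0" using R by (simp add: monic_orth_def)
  moreover have "grid_sum N w x (R * S) = grid_sum N (\<lambda>s. w s * (x s - a)) x (S * S)"
    by (simp add: grid_sum_def S algebra_simps)
  moreover have "weighted_grid N (\<lambda>s. w s * (x s - a)) x"
    using inj w_pos a by unfold_locales auto
  ultimately show False
    using weighted_grid.grid_sum_square_pos[of N "\<lambda>s. w s * (x s - a)" x S] deg n \<open>S \<noteq> 0\<close> by simp
qed

text \<open>
  The factor \<open>x - a\<close> moved from the transformed polynomial to the weight turns it into a
  combination of \<open>R (n + 1)\<close> and \<open>R n\<close>, both orthogonal to all lower degrees.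
\<close>

lemma monic_orth_christoffel:
  assumes R: "monic_orth N w x n (R n)" "monic_orth N w x (n + 1) (R (n + 1))"
    and n: "n \<le> N" and a: "\<And>s. s \<le> N \<Longrightarrow> a < x s"
  shows "monic_orth N (\<lambda>s. w s * (x s - a)) x n (christoffel_transform R a n)"
proof -
  define T where "T = christoffel_transform R a n"
  define c where "c = poly (R (n + 1)) a / poly (R n) a"
  have ex: "[:- a, 1:] * T = R (n + 1) - smult c (R n)"
    unfolding T_def c_def using poly_monic_orth_nonzero[OF R(1) n a]
    by (rule christoffel_transform_exact)
  have "degree (smult c (R n)) < n + 1"
    using R by (auto simp: monic_orth_def)
  then have D: "degree ([:- a, 1:] * T) = n + 1" "coeff ([:- a, 1:] * T) (n + 1) = 1"
    unfolding ex using R by (intro monic_diff_lower_degree; simp add: monic_orth_def)+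
  have "T \<noteq> 0" using D by auto
  then have "degree ([:- a, 1:] * T) = degree T + 1" by (subst degree_mult_eq) simp_all
  then have "degree T = n" using D(1) by simp
  moreover from this have "coeff T n = 1" using D(2) by (simp add: coeff_eq_0)
  moreover have "grid_sum N (\<lambda>s. w s * (x s - a)) x (T * q) = 0" if "degree q < n" for q
  proof -
    have "grid_sum N (\<lambda>s. w s * (x s - a)) x (T * q) = grid_sum N w x ([:- a, 1:] * T * q)"
      by (simp add: grid_sum_def algebra_simps)
    also have "\<dots> = grid_sum N w x (R (n + 1) * q) - c * grid_sum N w x (R n * q)"
      unfolding ex by (simp add: left_diff_distrib grid_sum_diff grid_sum_smult)
    also have "\<dots> = 0" using R that by (simp add: monic_orth_def)
    finally show ?thesis .
  qed
  ultimately show ?thesis by (simp add: monic_orth_def T_def)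
qed

end

section \<open>The weight of a Sturmian sequence\<close>

lemma poly_pderiv_grid_poly:
  assumes "s \<le> N"
  shows "poly (pderiv (grid_poly N x)) (x s) = (\<Prod>t\<in>{..N} - {s}. x s - x t)"
proof -
  have "poly (pderiv (grid_poly N x)) (x s) =
      (\<Sum>a\<le>N. \<Prod>t\<in>{..N} - {a}. x s - x t)"
    by (simp add: grid_poly_def pderiv_prod poly_sum poly_prod pderiv_pCons)
  also have "\<dots> = (\<Prod>t\<in>{..N} - {s}. x s - x t)"
    using assms by (subst sum.remove[of _ s]) (auto intro!: sum.neutral)
  finally show ?thesis .
qed

lemma grid_poly_monic: "degree (grid_poly N x) = N + 1" "coeff (grid_poly N x) (N + 1) = 1"
  using prod_linear_monic[of "{..N}" x] by (simp_all add: grid_poly_def)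

lemma pderiv_grid_poly_nonzero:
  assumes "inj_on x {..N}" "s \<le> N"
  shows "poly (pderiv (grid_poly N x)) (x s) \<noteq> 0"
  using assms by (auto simp: poly_pderiv_grid_poly inj_on_def)

text \<open>
  Comparison of the coefficients of \<open>x\<^sup>N\<close> in Lagrange's interpolation formula for \<open>q\<close>; the sum
  is the divided difference of \<open>q\<close> over the nodes.
\<close>

lemma sum_poly_over_pderiv_grid:
  assumes inj: "inj_on x {..N}" and q: "degree q \<le> N"
  shows "(\<Sum>s\<le>N. poly q (x s) / poly (pderiv (grid_poly N x)) (x s)) = coeff q N"
proof -
  define l where "l s = (\<Prod>t\<in>{..N} - {s}. [:- x t, 1:])" for s
  define c where "c s = poly q (x s) / poly (pderiv (grid_poly N x)) (x s)" for s
  have l: "degree (l s) = N" "coeff (l s) N = 1" if "s \<le> N" for s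
    unfolding l_def using that prod_linear_monic[of "{..N} - {s}" x] by simp_all
  have "q = (\<Sum>s\<le>N. smult (c s) (l s))"
  proof (rule poly_eqI_degree[of "x ` {..N}"])
    fix y assume "y \<in> x ` {..N}"
    then obtain r where r: "r \<le> N" "y = x r" by auto
    have "poly (\<Sum>s\<le>N. smult (c s) (l s)) y = (\<Sum>s\<le>N. c s * poly (l s) (x r))"
      by (simp add: poly_sum r)
    also have "\<dots> = c r * poly (l r) (x r)"
      using r by (subst sum.remove[of _ r]) (auto intro!: sum.neutral simp: l_def poly_prod)
    also have "poly (l r) (x r) = poly (pderiv (grid_poly N x)) (x r)"
      using r by (simp add: poly_pderiv_grid_poly l_def poly_prod)
    finally show "poly q y = poly (\<Sum>s\<le>N. smult (c s) (l s)) y"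
      using pderiv_grid_poly_nonzero[OF inj r(1)] by (simp add: c_def r)
  next
    have "degree (\<Sum>s\<le>N. smult (c s) (l s)) \<le> N"
      using l by (intro degree_sum_le) (auto intro: order_trans[OF degree_smult_le])
    then show "degree (\<Sum>s\<le>N. smult (c s) (l s)) < card (x ` {..N})"
      using inj by (simp add: card_image)
  qed (use q inj in \<open>simp add: card_image\<close>)
  then have "coeff q N = (\<Sum>s\<le>N. c s * coeff (l s) N)"
    by (metis (no_types, lifting) coeff_smult coeff_sum sum.cong)
  also have "\<dots> = (\<Sum>s\<le>N. c s)" using l by (intro sum.cong) auto
  finally show ?thesis by (simp add: c_def)
qed

text \<open>
  One factor \<open>P'(x\<^sub>s)\<close> cancels against the weight \<open>1 / P'(x\<^sub>s)\<^sup>2\<close>, and what remains is a divided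
  difference of order \<open>N\<close> of a polynomial of degree below \<open>N\<close>.
\<close>

lemma monic_orth_pderiv_grid_poly:
  assumes inj: "inj_on x {..N}"
  shows "monic_orth N (\<lambda>s. 1 / (poly (pderiv (grid_poly N x)) (x s))\<^sup>2) x N
    (smult (inverse (real (N + 1))) (pderiv (grid_poly N x)))"
proof -
  let ?P = "pderiv (grid_poly N x)"
  have "degree ?P = N" using grid_poly_monic[of N x] by (simp add: degree_pderiv)
  moreover have "coeff ?P N = real (N + 1)"
    using grid_poly_monic[of N x] by (simp add: coeff_pderiv)
  moreover have "grid_sum N (\<lambda>s. 1 / (poly ?P (x s))\<^sup>2) x (smult c ?P * q) = 0"
    if "degree q < N" for q c
  proof -
    have "grid_sum N (\<lambda>s. 1 / (poly ?P (x s))\<^sup>2) x (smult c ?P * q)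
        = c * (\<Sum>s\<le>N. poly q (x s) / poly ?P (x s))"
      unfolding grid_sum_def sum_distrib_left
      using pderiv_grid_poly_nonzero[OF inj]
      by (intro sum.cong) (auto simp: power2_eq_square field_simps)
    also have "\<dots> = 0"
      using that by (simp add: sum_poly_over_pderiv_grid[OF inj] coeff_eq_0)
    finally show ?thesis .
  qed
  ultimately show ?thesis by (simp add: monic_orth_def)
qed

lemma monic_orth_grid_poly: "monic_orth N w x (N + 1) (grid_poly N x)"
proof -
  have "poly (grid_poly N x) (x s) = 0" if "s \<le> N" for s
    using that by (auto simp: grid_poly_def poly_prod)
  then show ?thesis using grid_poly_monic[of N x] by (simp add: monic_orth_def grid_sum_def)
qed

text \<open>
  The Sturmian sequence of an arbitrary grid consists of the orthogonal polynomials for the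
  weight \<open>1 / P'(x\<^sub>s)\<^sup>2\<close>: these satisfy a three-term recurrence with positive \<open>u\<close>, and they end
  in \<open>P' / (N + 1)\<close> and \<open>P\<close>, so that the Euclidean algorithm runs through them backwards.
\<close>

lemma sturmian_poly_eq_monic_orth:
  assumes inj: "inj_on x {..N}"
    and T: "\<And>n. n \<le> N \<Longrightarrow>
      monic_orth N (\<lambda>s. 1 / (poly (pderiv (grid_poly N x)) (x s))\<^sup>2) x n (T n)"
    and n: "n \<le> N"
  shows "sturmian_poly N x n = T n"
proof -
  define v where "v = (\<lambda>s. 1 / (poly (pderiv (grid_poly N x)) (x s))\<^sup>2)"
  interpret weighted_grid N v x
    using inj pderiv_grid_poly_nonzero[OF inj] by unfold_locales (auto simp: v_def)
  define P where "P m = (if m \<le> N then T m else grid_poly N x)" for m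
  have P: "monic_orth N v x m (P m)" if "m \<le> N + 1" for m
    using that T monic_orth_grid_poly[of N v x] le_Suc_eq[of m N] by (auto simp: P_def v_def)
  define h where "h m = grid_sum N v x (P m * P m)" for m
  have "sturmian_poly N x n = P n"
  proof (rule sturmian_poly_unique[where u = "\<lambda>m. h m / h (m - 1)" and
        b = "\<lambda>m. grid_sum N v x ([:0, 1:] * P m * P m) / h m"])
    show "P (N + 1) = grid_poly N x" by (simp add: P_def)
    show "P N = smult (inverse (real (N + 1))) (pderiv (grid_poly N x))"
      using P[of N] monic_orth_pderiv_grid_poly[OF inj]
      by (intro monic_orth_unique) (auto simp: v_def)
    show "degree (P m) = m \<and> lead_coeff (P m) = 1" if "m \<le> N + 1" for m
      using P[OF that] by (simp add: monic_orth_def)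
  qed (use three_term_recurrence[of P] P n in \<open>auto simp: h_def\<close>)
  then show ?thesis using n by (simp add: P_def)
qed

section \<open>The Racah difference equation on the grid \<open>s (s + 2)\<close>\<close>

text \<open>
  The Newton basis of the grid: \<open>newton k s\<close> is the product of \<open>x\<^sub>j - x\<^sub>s\<close> over \<open>j < k\<close>.
\<close>

definition newton :: "nat \<Rightarrow> real \<Rightarrow> real" where
  "newton k s = pochhammer (- s) k * pochhammer (s + 2) k"

text \<open>
  The Racah difference operator \<open>B(s) (f(s+1) - f(s)) + D(s) (f(s-1) - f(s))\<close> for
  \<open>\<alpha> = -N-1\<close>, \<open>\<beta> = -N-3/2\<close>, \<open>\<gamma> = \<delta> = 1/2\<close> has \<open>B(s) = (N-s)\<^sup>2 (s+2) / (4 (s+1))\<close> and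
  \<open>D(s) = s (s+N+2)\<^sup>2 / (4 (s+1))\<close>. The common denominator \<open>4 (s+1)\<close> is cleared, which makes
  the eigenvalue equations polynomial identities, valid for every real \<open>s\<close>.
\<close>

definition racah_op :: "nat \<Rightarrow> (real \<Rightarrow> real) \<Rightarrow> real \<Rightarrow> real" where
  "racah_op N f s = (real N - s)\<^sup>2 * (s + 2) * (f (s + 1) - f s)
     + s * (s + real N + 2)\<^sup>2 * (f (s - 1) - f s)"

lemma racah_op_sum:
  fixes n :: nat
  shows "racah_op N (\<lambda>s. \<Sum>k\<le>n. a k * f k s) s = (\<Sum>k\<le>n. a k * racah_op N (f k) s)"
  by (induction n) (simp_all add: racah_op_def algebra_simps)

definition racah_eigenvalue :: "nat \<Rightarrow> nat \<Rightarrow> real" where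
  "racah_eigenvalue N n = real n * (real n - 2 * real N - 3/2)"

text \<open>
  The operator is bidiagonal in the Newton basis. Indeed \<open>newton (Suc k)\<close> at \<open>s - 1\<close>, \<open>s\<close>
  and \<open>s + 1\<close> and \<open>newton k\<close> at \<open>s\<close> have a common product of Pochhammer symbols of length
  \<open>k - 1\<close>; the quotients by it are polynomials in \<open>s\<close> and \<open>k\<close> of bounded degree.
\<close>

lemma racah_op_newton:
  "racah_op N (newton (Suc k)) s = 4 * (s + 1) *
     (racah_eigenvalue N (Suc k) * newton (Suc k) s
      - (real k + 1) * (real k + 3/2) * (real k - real N)\<^sup>2 * newton k s)"
proof (cases k)
  case 0
  show ?thesis
    by (simp add: 0 racah_op_def newton_def racah_eigenvalue_def power2_eq_square field_simps)
next
  case (Suc m)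
  define G where "G = pochhammer (1 - s) m"
  define H where "H = pochhammer (s + 3) m"
  have G: "pochhammer (- (s + 1)) (Suc (Suc m)) = (- s - 1) * (- s) * G"
    "pochhammer (- s) (Suc (Suc m)) = (- s) * G * (real m + 1 - s)"
    "pochhammer (- (s - 1)) (Suc (Suc m)) = G * (real m + 1 - s) * (real m + 2 - s)"
    "pochhammer (- s) (Suc m) = (- s) * G"
  proof -
    show "pochhammer (- (s + 1)) (Suc (Suc m)) = (- s - 1) * (- s) * G"
      by (simp add: G_def pochhammer_rec algebra_simps)
    show "pochhammer (- s) (Suc (Suc m)) = (- s) * G * (real m + 1 - s)"
      by (subst pochhammer_rec, subst pochhammer_Suc) (simp add: G_def algebra_simps)
    show "pochhammer (- (s - 1)) (Suc (Suc m)) = G * (real m + 1 - s) * (real m + 2 - s)"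
      by (subst pochhammer_Suc, subst pochhammer_Suc) (simp add: G_def algebra_simps)
    show "pochhammer (- s) (Suc m) = (- s) * G"
      by (simp add: G_def pochhammer_rec algebra_simps)
  qed
  have H: "pochhammer (s + 1 + 2) (Suc (Suc m)) = H * (s + 3 + m) * (s + 4 + m)"
    "pochhammer (s + 2) (Suc (Suc m)) = (s + 2) * H * (s + 3 + m)"
    "pochhammer (s - 1 + 2) (Suc (Suc m)) = (s + 1) * (s + 2) * H"
    "pochhammer (s + 2) (Suc m) = (s + 2) * H"
  proof -
    have 3: "s + 1 + 2 = s + 3" "s - 1 + 2 = s + 1" by simp_all
    show "pochhammer (s + 1 + 2) (Suc (Suc m)) = H * (s + 3 + m) * (s + 4 + m)"
      unfolding 3 by (subst pochhammer_Suc, subst pochhammer_Suc) (simp add: H_def algebra_simps)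
    show "pochhammer (s + 2) (Suc (Suc m)) = (s + 2) * H * (s + 3 + m)"
      by (subst pochhammer_rec, subst pochhammer_Suc) (simp add: H_def add.assoc)
    show "pochhammer (s - 1 + 2) (Suc (Suc m)) = (s + 1) * (s + 2) * H"
      unfolding 3 by (simp add: H_def pochhammer_rec add.assoc)
    show "pochhammer (s + 2) (Suc m) = (s + 2) * H"
      by (simp add: H_def pochhammer_rec add.assoc)
  qed
  (* Opaque names for the casts leave a ring identity in s, M, n, G and H. *)
  define M where "M = real m"
  define n where "n = real N"
  show ?thesis
    unfolding racah_op_def newton_def racah_eigenvalue_def Suc G H of_nat_Suc power2_eq_square
    unfolding M_def[symmetric] n_def[symmetric]
    by algebra
qed

definition racah_coeff :: "nat \<Rightarrow> nat \<Rightarrow> nat \<Rightarrow> real" where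
  "racah_coeff N n k = pochhammer (- real n) k * pochhammer (real n - 2 * real N - 3/2) k /
     ((pochhammer (- real N) k)\<^sup>2 * pochhammer (3/2) k * fact k)"

abbreviation racah_hyp' :: "nat \<Rightarrow> nat \<Rightarrow> real poly" where
  "racah_hyp' N \<equiv> racah_hyp N (- real N - 3/2) (1/2) (1/2)"

lemma racah_grid_half: "racah_grid (1/2) (1/2) s = s * (s + 2)"
  by (simp add: racah_grid_def algebra_simps)

lemma poly_racah_hyp_newton:
  "poly (racah_hyp' N n) (s * (s + 2)) = (\<Sum>k\<le>n. racah_coeff N n k * newton k s)"
proof -
  have "real n + (- real N - 3/2) - real N = real n - 2 * real N - 3/2"
    "- real N - 3/2 + 1/2 + 1 = - real N" "(1/2 + 1 :: real) = 3/2" "s + 1/2 + 1/2 + 1 = s + 2"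
    by simp_all
  then show ?thesis
    using poly_racah_hyp[of N "- real N - 3/2" "1/2" "1/2" n s]
    unfolding racah_grid_half
    by (simp only: racah_coeff_def newton_def power2_eq_square times_divide_eq_left
        times_divide_eq_right mult.assoc)
qed

text \<open>
  Exactly the recurrence under which a combination of Newton polynomials solves the bidiagonal
  eigenvalue equation for \<open>racah_eigenvalue N n\<close>.
\<close>

lemma racah_coeff_Suc:
  assumes "k < N"
  shows "racah_coeff N n (Suc k) * ((real k + 1) * (real k + 3/2) * (real k - real N)\<^sup>2) =
    (racah_eigenvalue N k - racah_eigenvalue N n) * racah_coeff N n k"
proof -
  define A where "A = pochhammer (- real n) k * pochhammer (real n - 2 * real N - 3/2) k"
  define D where "D = (pochhammer (- real N) k)\<^sup>2 * pochhammer (3/2) k * fact k"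
  define c where "c = (real k + 1) * (real k + 3/2) * (real k - real N)\<^sup>2"
  have "c \<noteq> 0" using assms by (auto simp: c_def)
  have "racah_coeff N n (Suc k) =
      A * ((real k - real n) * (real n - 2 * real N - 3/2 + real k)) / (D * c)"
    unfolding racah_coeff_def A_def D_def c_def
    by (simp add: pochhammer_Suc power_mult_distrib mult_ac add_ac)
  moreover have "racah_coeff N n k = A / D" by (simp add: racah_coeff_def A_def D_def)
  moreover have "racah_eigenvalue N k - racah_eigenvalue N n =
      (real k - real n) * (real n - 2 * real N - 3/2 + real k)"
    by (simp add: racah_eigenvalue_def field_simps)
  ultimately show ?thesis using \<open>c \<noteq> 0\<close> unfolding c_def[symmetric] by simp
qed

text \<open>
  The off-diagonal term of index \<open>k + 1\<close> joins the diagonal term of index \<open>k\<close>, and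
  \<open>racah_coeff_Suc\<close> replaces the eigenvalue \<open>racah_eigenvalue N k\<close> by that of \<open>n\<close>.
\<close>

lemma racah_op_eigenfunction:
  assumes "n \<le> N"
  shows "racah_op N (\<lambda>s. poly (racah_hyp' N n) (s * (s + 2))) s =
    4 * (s + 1) * racah_eigenvalue N n * poly (racah_hyp' N n) (s * (s + 2))"
proof -
  let ?a = "racah_coeff N n" and ?l = "racah_eigenvalue N"
  define c where "c k = real k * (real k + 1/2) * (real k - 1 - real N)\<^sup>2" for k
  (* At k = 0 the truncated index k - 1 occurs with the factor c 0 = 0. *)
  have op: "racah_op N (newton k) s =
      4 * (s + 1) * (?l k * newton k s - c k * newton (k - 1) s)" for k
  proof (cases k)
    case 0
    then show ?thesis by (simp add: racah_op_def newton_def racah_eigenvalue_def c_def)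
  next
    case (Suc j)
    have "c k = (real j + 1) * (real j + 3/2) * (real j - real N)\<^sup>2"
      by (simp add: Suc c_def algebra_simps)
    then show ?thesis using racah_op_newton[of N j s] Suc by simp
  qed
  have "racah_op N (\<lambda>s. poly (racah_hyp' N n) (s * (s + 2))) s =
      (\<Sum>k\<le>n. ?a k * racah_op N (newton k) s)"
    unfolding poly_racah_hyp_newton by (rule racah_op_sum)
  also have "\<dots> = 4 * (s + 1) *
      ((\<Sum>k\<le>n. ?l k * ?a k * newton k s) - (\<Sum>k\<le>n. ?a k * c k * newton (k - 1) s))"
    unfolding op sum_subtractf[symmetric] sum_distrib_left
    by (intro sum.cong) (simp_all add: algebra_simps)
  also have "(\<Sum>k\<le>n. ?a k * c k * newton (k - 1) s) =
      (\<Sum>k<n. ?a (Suc k) * c (Suc k) * newton k s)"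
    by (subst sum.atMost_shift) (simp add: c_def)
  also have "\<dots> = (\<Sum>k<n. (?l k - ?l n) * ?a k * newton k s)"
  proof (intro sum.cong refl)
    fix k assume "k \<in> {..<n}"
    moreover have "c (Suc k) = (real k + 1) * (real k + 3/2) * (real k - real N)\<^sup>2"
      by (simp add: c_def algebra_simps)
    ultimately show "?a (Suc k) * c (Suc k) * newton k s = (?l k - ?l n) * ?a k * newton k s"
      using racah_coeff_Suc[of k N n] assms by simp
  qed
  (* The added term k = n is zero: this is where the hypergeometric series terminates. *)
  also have "\<dots> = (\<Sum>k\<le>n. (?l k - ?l n) * ?a k * newton k s)"
    by (simp add: lessThan_Suc_atMost[symmetric])
  also have "(\<Sum>k\<le>n. ?l k * ?a k * newton k s) - \<dots> = ?l n * (\<Sum>k\<le>n. ?a k * newton k s)"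
    by (simp add: sum_subtractf[symmetric] sum_distrib_left algebra_simps)
  finally show ?thesis by (simp add: poly_racah_hyp_newton)
qed

section \<open>Orthogonality of the Racah polynomials\<close>

text \<open>
  The right-hand side is symmetric in \<open>f\<close> and \<open>g\<close> up to a boundary term. At \<open>s = 0\<close> the
  truncated \<open>f (s - 1)\<close> is multiplied by \<open>d 0 = 0\<close>.
\<close>

lemma sum_by_parts_second_order:
  fixes e d f g :: "nat \<Rightarrow> real"
  assumes "d 0 = 0" and "\<And>s. s < M \<Longrightarrow> d (Suc s) = e s"
  shows "(\<Sum>s\<le>M. (e s * (f (Suc s) - f s) + d s * (f (s - 1) - f s)) * g s) =
    e M * (f (Suc M) - f M) * g M - (\<Sum>s<M. e s * (f (Suc s) - f s) * (g (Suc s) - g s))"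
  using assms by (induction M) (simp_all add: algebra_simps)

text \<open>
  Up to a constant factor the Racah weight for these parameters, \<open>((s+1) (-N)\<^sub>s / (N+3)\<^sub>s)\<^sup>2\<close>.
  The constant is the one for which \<open>racah_weight_sturm\<close> below is an equality.
\<close>

definition racah_weight :: "nat \<Rightarrow> nat \<Rightarrow> real" where
  "racah_weight N s = (2 * (real s + 1) / (fact (N - s) * fact (N + s + 2)))\<^sup>2"

text \<open>
  The weight satisfies \<open>w(s+1) D(s+1) = w(s) B(s)\<close>, and \<open>D(0) = B(N) = 0\<close>, so summation by parts
  leaves no boundary term.
\<close>

lemma racah_op_self_adjoint:
  "(\<Sum>s\<le>N. racah_weight N s / (4 * (real s + 1)) * racah_op N f (real s) * g (real s)) =
   (\<Sum>s\<le>N. racah_weight N s / (4 * (real s + 1)) * racah_op N g (real s) * f (real s))"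
proof -
  define v where "v s = racah_weight N s / (4 * (real s + 1))" for s
  define e where "e s = v s * ((real N - real s)\<^sup>2 * (real s + 2))" for s
  define d where "d s = v s * (real s * (real s + real N + 2)\<^sup>2)" for s
  have v: "v s = (real s + 1) / (fact (N - s) * fact (N + s + 2))\<^sup>2" for s
  proof -
    have "(2 * z / K)\<^sup>2 / (4 * z) = z / K\<^sup>2" if "z \<noteq> 0" for z K :: real
      using that by (simp add: power2_eq_square)
    moreover have "real s + 1 \<noteq> 0" by linarith
    ultimately show ?thesis by (simp only: v_def racah_weight_def)
  qed
  have d0: "d 0 = 0" by (simp add: d_def)
  have de: "d (Suc s) = e s" if "s < N" for s
  proof -
    define F where "F = (fact (N - Suc s) * fact (N + s + 2) :: real)"
    have F: "F \<noteq> 0" by (simp add: F_def)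
    have N: "N - s = Suc (N - Suc s)" "real N - real s = real (Suc (N - Suc s))"
      using that by auto
    have f1: "fact (N - s) * fact (N + s + 2) = (real N - real s) * F"
      unfolding F_def N(2) by (subst N(1)) (simp only: fact_Suc mult.assoc)
    have f2: "fact (N - Suc s) * fact (N + Suc s + 2) = (real N + real s + 3) * F"
      by (simp add: F_def algebra_simps)
    have nz: "real N - real s \<noteq> 0" "real N + real s + 3 \<noteq> 0" "real s + 1 \<noteq> 0" "real s + 2 \<noteq> 0"
      using that by linarith+
    have "e s = (real s + 1) * (real s + 2) / F\<^sup>2"
      unfolding e_def v f1 using nz F by (simp add: power_mult_distrib)
    moreover have "d (Suc s) = (real s + 1) * (real s + 2) / F\<^sup>2"
    proof -
      have "real (Suc s) + 1 = real s + 2" "real (Suc s) + real N + 2 = real N + real s + 3"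
        "real (Suc s) = real s + 1" by simp_all
      then show ?thesis
        unfolding d_def v f2 using nz F by (simp only: power_mult_distrib) simp
    qed
    ultimately show ?thesis by simp
  qed
  have eN: "e N = 0" by (simp add: e_def)
  have form: "(\<Sum>s\<le>N. v s * racah_op N f (real s) * g (real s)) =
      - (\<Sum>s<N. e s * (f (real (Suc s)) - f (real s)) * (g (real (Suc s)) - g (real s)))" for f g
  proof -
    have "v s * racah_op N f (real s) = e s * (f (real (Suc s)) - f (real s)) +
        d s * (f (real (s - 1)) - f (real s))" for s
      by (cases s) (simp_all add: racah_op_def e_def d_def algebra_simps)
    then show ?thesis
      using sum_by_parts_second_order[of d N e "\<lambda>s. f (real s)" "\<lambda>s. g (real s)"] d0 de eN by simp
  qed
  show ?thesis unfolding v_def[symmetric] form by (simp add: mult_ac)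
qed

abbreviation quad_grid :: "nat \<Rightarrow> real" where
  "quad_grid s \<equiv> real s * (real s + 2)"

text \<open>
  Eigenfunctions of a self-adjoint operator with distinct eigenvalues. They are distinct because
  \<open>n + m \<le> 2 N < 2 N + 3/2\<close>.
\<close>

lemma racah_hyp_orthogonal:
  assumes "m \<le> N" "n \<le> N" "m \<noteq> n"
  shows "grid_sum N (racah_weight N) quad_grid (racah_hyp' N n * racah_hyp' N m) = 0"
proof -
  define y where "y n = (\<lambda>s. poly (racah_hyp' N n) (s * (s + 2)))" for n
  let ?S = "grid_sum N (racah_weight N) quad_grid (racah_hyp' N n * racah_hyp' N m)"
  have eig: "(\<Sum>s\<le>N. racah_weight N s / (4 * (real s + 1)) *
        racah_op N (y i) (real s) * y j (real s)) =
      racah_eigenvalue N i * (\<Sum>s\<le>N. racah_weight N s * (y i (real s) * y j (real s)))"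
    if "i \<le> N" for i j
    unfolding sum_distrib_left
  proof (intro sum.cong refl)
    fix s
    have "racah_op N (y i) (real s) = 4 * (real s + 1) * racah_eigenvalue N i * y i (real s)"
      using racah_op_eigenfunction[OF that, of "real s"] by (simp add: y_def)
    moreover have "real s + 1 \<noteq> 0" by linarith
    ultimately show "racah_weight N s / (4 * (real s + 1)) *
          racah_op N (y i) (real s) * y j (real s) =
        racah_eigenvalue N i * (racah_weight N s * (y i (real s) * y j (real s)))"
      by simp
  qed
  have S: "?S = (\<Sum>s\<le>N. racah_weight N s * (y n (real s) * y m (real s)))"
    "?S = (\<Sum>s\<le>N. racah_weight N s * (y m (real s) * y n (real s)))"
    by (simp_all add: grid_sum_def y_def mult_ac)
  have "racah_eigenvalue N n * ?S = racah_eigenvalue N m * ?S"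
    using racah_op_self_adjoint[of N "y n" "y m"] unfolding eig[OF assms(1)] eig[OF assms(2)]
    unfolding S(1)[symmetric] S(2)[symmetric] .
  moreover have "racah_eigenvalue N n - racah_eigenvalue N m =
      (real n - real m) * (real n + real m - 2 * real N - 3/2)"
    by (simp add: racah_eigenvalue_def field_simps)
  then have "racah_eigenvalue N n \<noteq> racah_eigenvalue N m"
    using assms by auto
  ultimately show ?thesis by simp
qed

abbreviation sturm_racah :: "nat \<Rightarrow> nat \<Rightarrow> real poly" where
  "sturm_racah N \<equiv> racah_poly N (- real N - 3/2) (1/2) (1/2)"

lemma monic_orth_racah:
  assumes "n \<le> N + 1"
  shows "monic_orth N (racah_weight N) quad_grid n (sturm_racah N n)"
proof (cases "n = N + 1")
  case True
  then show ?thesis using monic_orth_grid_poly[of N "racah_weight N" quad_grid]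
    by (simp add: racah_poly_def racah_grid_half)
next
  case False
  have monic: "degree (sturm_racah N m) = m \<and> lead_coeff (sturm_racah N m) = 1" if "m \<le> N" for m
  proof -
    have "pochhammer (real m + (- real N - 3/2) - real N) m \<noteq> 0"
      using that by (auto simp: pochhammer_eq_0_iff)
    moreover have "pochhammer (- real N - 3/2 + 1/2 + 1) m \<noteq> 0" 
      using that by (simp add: pochhammer_of_nat_eq_0_iff)
    moreover have "pochhammer (1/2 + 1 :: real) m \<noteq> 0"
      using pochhammer_pos[of "3/2::real" m] by simp
    ultimately show ?thesis using racah_poly_monic[OF that] by blast
  qed
  have orth: "grid_sum N (racah_weight N) quad_grid (sturm_racah N n * sturm_racah N m) = 0"
    if "m < n" for m
    using racah_hyp_orthogonal[of m N n] that False assms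
    by (simp add: racah_poly_def make_monic_def grid_sum_smult)
  have "grid_sum N (racah_weight N) quad_grid (sturm_racah N n * q) = 0" if "degree q < n" for q
  proof (rule grid_sum_eq_0_of_basis[OF _ orth that])
    fix m assume "m < n"
    then have "degree (sturm_racah N m) = m" "lead_coeff (sturm_racah N m) = 1"
      using monic[of m] False assms by auto
    then show "degree (sturm_racah N m) = m \<and> sturm_racah N m \<noteq> 0" by auto
  qed
  then show ?thesis using monic[of n] False assms by (auto simp: monic_orth_def)
qed

section \<open>The Sturmian weight on the grid \<open>s (s + 2)\<close>\<close>

text \<open>
  From \<open>x\<^sub>s - x\<^sub>t = (s - t) (s + t + 2)\<close>. The induction starts at \<open>N = s\<close>, where all factors are
  positive; each further node contributes one negative factor.
\<close>

lemma poly_pderiv_quad_grid: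
  assumes "s \<le> N"
  shows "poly (pderiv (grid_poly N quad_grid)) (quad_grid s) =
    (- 1) ^ (N - s) * fact (N - s) * fact (N + s + 2) / (2 * (real s + 1)\<^sup>2)"
proof -
  have "(\<Prod>t\<in>{..N} - {s}. quad_grid s - quad_grid t) =
      (- 1) ^ (N - s) * fact (N - s) * fact (N + s + 2) / (2 * (real s + 1)\<^sup>2)"
    using assms
  proof (induction N rule: dec_induct)
    case base
    have "(\<Prod>t\<in>{..s} - {s}. quad_grid s - quad_grid t) =
        (\<Prod>t<s. real (s - t) * (real (s + 2) + real t))"
      by (intro prod.cong) (auto simp: of_nat_diff algebra_simps)
    also have "\<dots> = fact s * pochhammer (real (s + 2)) s"
      by (simp add: prod.distrib fact_prod_rev pochhammer_prod lessThan_atLeast0)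
    also have "\<dots> = fact (s + s + 2) / (2 * (real s + 1)\<^sup>2)"
    proof -
      have "fact (Suc s) * pochhammer (real (s + 2)) s = fact (s + s + 1)"
        using pochhammer_product[of "Suc s" "s + s + 1" "1::real"]
        by (simp add: pochhammer_fact algebra_simps)
      then have "(real s + 1) * (fact s * pochhammer (real (s + 2)) s) = fact (s + s + 1)"
        by (simp add: algebra_simps)
      moreover have "fact (s + s + 2) = 2 * (real s + 1) * fact (s + s + 1)"
        by (simp add: algebra_simps)
      moreover have "c = 2 * z * (z * c) / (2 * z\<^sup>2)" if "z \<noteq> 0" for c z :: real
        using that by (simp add: power2_eq_square)
      from this[of "real s + 1" "fact s * pochhammer (real (s + 2)) s"]
      have "fact s * pochhammer (real (s + 2)) s = 2 * (real s + 1) *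
          ((real s + 1) * (fact s * pochhammer (real (s + 2)) s)) / (2 * (real s + 1)\<^sup>2)"
        by linarith
      ultimately show ?thesis by (simp only:)
    qed
    finally show ?case by simp
  next
    case (step n)
    have "{..Suc n} - {s} = insert (Suc n) ({..n} - {s})" using step by auto
    then have "(\<Prod>t\<in>{..Suc n} - {s}. quad_grid s - quad_grid t) =
        (quad_grid s - quad_grid (Suc n)) * (\<Prod>t\<in>{..n} - {s}. quad_grid s - quad_grid t)"
      by simp
    also have "quad_grid s - quad_grid (Suc n) = - real (Suc (n - s)) * (real n + real s + 3)"
      using step by (simp add: of_nat_diff algebra_simps)
    finally have "(\<Prod>t\<in>{..Suc n} - {s}. quad_grid s - quad_grid t) =
        - real (Suc (n - s)) * (real n + real s + 3) *
          ((- 1) ^ (n - s) * fact (n - s) * fact (n + s + 2) / (2 * (real s + 1)\<^sup>2))"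
      unfolding step.IH .
    moreover have "Suc n - s = Suc (n - s)" using step by simp
    moreover have "fact (Suc n + s + 2) = (real n + real s + 3) * fact (n + s + 2)"
      by (simp add: algebra_simps)
    moreover have "- r * c * (e * a * b / z) = - 1 * e * (r * a) * (c * b) / z"
      for a b c e r z :: real
      by simp
    ultimately show ?case by (simp only: fact_Suc power_Suc)
  qed
  then show ?thesis using assms poly_pderiv_grid_poly[of s N quad_grid] by simp
qed

text \<open>
  The link between the two families: since \<open>x\<^sub>s + 1 = (s + 1)\<^sup>2\<close>, the Christoffel factor at
  \<open>-1\<close> turns the Racah weight into the Sturmian weight.
\<close>

lemma racah_weight_sturm:
  assumes "s \<le> N"
  shows "racah_weight N s * (quad_grid s - (- 1)) =
    1 / (poly (pderiv (grid_poly N quad_grid)) (quad_grid s))\<^sup>2"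
proof -
  define e a b z :: real
    where "e = (- 1) ^ (N - s)" and "a = fact (N - s)" and "b = fact (N + s + 2)"
      and "z = real s + 1"
  have z: "z \<noteq> 0" "quad_grid s - (- 1) = z\<^sup>2"
    by (simp_all add: z_def power2_eq_square algebra_simps)
  have e: "e\<^sup>2 = 1" by (simp add: e_def flip: power_mult)
  have "(2 * z / (a * b))\<^sup>2 * z\<^sup>2 = 1 / (e * a * b / (2 * z\<^sup>2))\<^sup>2"
    using z(1) e by (simp add: power_divide power_mult_distrib)
  then show ?thesis
    unfolding z(2) poly_pderiv_quad_grid[OF assms] racah_weight_def
    by (simp only: e_def a_def b_def z_def)
qed

section \<open>The Sturmian sequence as a Christoffel transform\<close>

lemma inj_on_quad_grid: "inj_on quad_grid A"
proof (rule strict_mono_on_imp_inj_on, rule strict_mono_onI)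
  fix r s :: nat
  assume "r < s"
  then show "quad_grid r < quad_grid s" by (intro mult_strict_mono) auto
qed

lemma quad_grid_gt_minus_1: "- 1 < quad_grid s"
  by (rule less_le_trans[of _ 0]) auto

lemma weighted_grid_racah: "weighted_grid N (racah_weight N) quad_grid"
proof
  show "0 < racah_weight N s" for s
  proof -
    have "real s + 1 \<noteq> 0" by linarith
    then show ?thesis by (simp add: racah_weight_def)
  qed
qed (rule inj_on_quad_grid)

lemma monic_orth_christoffel_racah:
  assumes "n \<le> N"
  shows "monic_orth N (\<lambda>s. 1 / (poly (pderiv (grid_poly N quad_grid)) (quad_grid s))\<^sup>2) quad_grid n
    (christoffel_transform (sturm_racah N) (- 1) n)"
proof (subst monic_orth_cong[OF racah_weight_sturm[symmetric]])
  show "monic_orth N (\<lambda>s. racah_weight N s * (quad_grid s - (- 1))) quad_grid n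
      (christoffel_transform (sturm_racah N) (- 1) n)"
    using assms quad_grid_gt_minus_1
    by (intro weighted_grid.monic_orth_christoffel[OF weighted_grid_racah] monic_orth_racah) auto
qed

theorem proposition4:
  fixes N n :: nat
  assumes "N \<ge> 1" and "n \<le> N"
  shows "poly (racah_poly N (- real N - 3/2) (1/2) (1/2) n) (-1) \<noteq> 0 \<and>
    sturmian_poly N (\<lambda>s. real s * (real s + 2)) n =
      christoffel_transform (racah_poly N (- real N - 3/2) (1/2) (1/2)) (-1) n"
proof
  show "poly (sturm_racah N n) (- 1) \<noteq> 0"
    using \<open>n \<le> N\<close> quad_grid_gt_minus_1
    by (intro weighted_grid.poly_monic_orth_nonzero[OF weighted_grid_racah monic_orth_racah]) simp_all
  show "sturmian_poly N quad_grid n = christoffel_transform (sturm_racah N) (- 1) n"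
    by (rule sturmian_poly_eq_monic_orth[OF inj_on_quad_grid monic_orth_christoffel_racah \<open>n \<le> N\<close>])
qed

end
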